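(* Suppose $\nu\in M_{\chi_\alpha,\sigma}(E)$ admits an admissible product gauge $\tau$. Then every stochastic representer of $\nu$ is concentrated on $E_\tau$. For every $E$-valued random element $Z$ concentrated on $E_\tau$, one has $Y_Z\in\Sigma_\tau$ and $Z=S_{R_Z}Y_Z$ almost surely, and $$\nu_Z(A)=\int_{\Sigma_\tau}K_A(y)\,\mu_Z(dy),\qquad A\in\mathcal E,$$ $$\mu_Z(D)=\int_{E_\tau}\chi_\alpha(\tau(x))\,h_\tau(x)\,\mathbb I_{\{\Pi_\tau x\in D\}}\,\nu_Z(dx),\qquad D\in\mathcal E|_{\Sigma_\tau}.$$ Moreover, $$\nu_Z=\nu\quad\Longleftrightarrow\quad\mu_Z=\varsigma_\tau,$$ and hence, for any $E$-valued random elements $Z,W$ concentrated on $E_\tau$, $\nu_Z=\nu_W$ is equivalent to $\mu_Z=\mu_W$.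
   Context: Let $q\ge1$ be an integer, $(E,\mathcal E)$ an arbitrary measurable space, and $G=(0,\infty)^q$ with coordinatewise multiplication and its Borel $\sigma$-field. Let $S:G\times E\to E$, $(r,x)\mapsto S_rx$, be a jointly measurable left action: $S_{\boldsymbol 1}x=x$ with $\boldsymbol 1=(1,\ldots,1)$, and $S_r(S_sx)=S_{rs}x$. Fix $\alpha\in(0,\infty)^q$ and put $\chi_\alpha(r)=\prod_{i=1}^q r_i^{\alpha_i}$, $\vartheta_\alpha(dr)=\prod_{i=1}^q\alpha_i r_i^{-\alpha_i-1}\,dr_i$ and $m_\alpha(dr)=\prod_{i=1}^q\alpha_i\,dr_i/r_i$ (measures on $G$). A measure $\nu$ on $(E,\mathcal E)$ is $\chi_\alpha$-homogeneous if $\nu(S_rA)=\chi_\alpha(r)^{-1}\nu(A)$ for all $r\in G$, $A\in\mathcal E$. $M_{\chi_\alpha,\sigma}(E)$ is the set of nonzero $\sigma$-finite $\chi_\alpha$-homogeneous measures. For an $E$-valued random element $Z$, $\nu_Z(A)=\mathbb E\left\{\int_G\mathbb I_A(S_rZ)\,\vartheta_\alpha(dr)\right\}$, $A\in\mathcal E$; $Z$ is a stochastic representer of $\nu$ if $\nu=\nu_Z$. For $A\in\mathcal E$, $K_A(x)=\int_G\mathbb I_A(S_rx)\,\vartheta_\alpha(dr)$. A product gauge is a measurable map $\tau=(\tau_1,\ldots,\tau_q):E\to[0,\infty)^q$ with $\tau(S_rx)=r\tau(x)$ (coordinatewise product) for all $r\in G$, $x\in E$; with $E_\tau:=\bigcap_{i=1}^q\{\tau_i>0\}$,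 it is admissible for $\nu$ if $\nu(E\setminus E_\tau)=0$. Given an admissible product gauge $\tau$ for $\nu$, put $\Sigma_\tau=\{x\in E_\tau:\tau(x)=\boldsymbol 1\}$ (nonempty), equipped with the trace $\sigma$-field $\mathcal E|_{\Sigma_\tau}$. Set $\Pi_\tau x=S_{\tau(x)^{-1}}x$ for $x\in E_\tau$ and $\Pi_\tau x=w_\tau$ for $x\notin E_\tau$, where $w_\tau\in\Sigma_\tau$ is fixed. Put $C_\star=(1,2]^q$, $d_\alpha=m_\alpha(C_\star)$, $h_\tau=d_\alpha^{-1}\mathbb I_{\{\tau\in C_\star\}}$, and let $\varsigma_\tau$ be the measure on $\Sigma_\tau$ given by $\varsigma_\tau(D)=\int_{E_\tau}\chi_\alpha(\tau(x))\,h_\tau(x)\,\mathbb I_{\{\Pi_\tau x\in D\}}\,\nu(dx)$, $D\in\mathcal E|_{\Sigma_\tau}$. A random element $Z$ is concentrated on $E_\tau$ if $\mathbb P\{Z\in E_\tau\}=1$. For such $Z$ put $R_Z=\tau(Z)$, $Y_Z=\Pi_\tau Z$ and $\mu_Z(D)=\mathbb E\{\chi_\alpha(R_Z)\mathbb I_{\{Y_Z\in D\}}\}$, $D\in\mathcal E|_{\Sigma_\tau}$. *)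

theory Defs
  imports "HOL-Probability.Probability"
begin

text \<open>
  The number of coordinates \<open>q \<ge> 1\<close> is the cardinality of the finite index type \<open>'q\<close>. On
  \<open>real ^ 'q\<close> the operation \<open>*\<close> is the coordinatewise product and \<open>1\<close> is the vector with all
  entries \<open>1\<close>. A measurable space is given by a value \<open>E\<close> of type \<open>'e measure\<close> of which only
  \<open>space E\<close> and \<open>sets E\<close> are used.
\<close>

definition pos_group :: "(real ^ 'q) set" where
  "pos_group = {r. \<forall>i. 0 < r $ i}"

definition vec_inverse :: "real ^ 'q \<Rightarrow> real ^ 'q" where
  "vec_inverse r = (\<chi> i. inverse (r $ i))"

definition character :: "real ^ 'q \<Rightarrow> real ^ 'q \<Rightarrow> real" where
  "character \<alpha> r = (\<Prod>i\<in>UNIV. r $ i powr \<alpha> $ i)"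

definition theta_measure :: "real ^ 'q \<Rightarrow> (real ^ 'q) measure" where
  "theta_measure \<alpha> =
     density (restrict_space lborel pos_group)
       (\<lambda>r. ennreal (\<Prod>i\<in>UNIV. \<alpha> $ i * r $ i powr (- \<alpha> $ i - 1)))"

definition haar_measure :: "real ^ 'q \<Rightarrow> (real ^ 'q) measure" where
  "haar_measure \<alpha> =
     density (restrict_space lborel pos_group) (\<lambda>r. ennreal (\<Prod>i\<in>UNIV. \<alpha> $ i / r $ i))"

definition measurable_action :: "'e measure \<Rightarrow> (real ^ 'q \<Rightarrow> 'e \<Rightarrow> 'e) \<Rightarrow> bool" where
  "measurable_action E S \<longleftrightarrow>
     (\<lambda>(r, x). S r x) \<in> restrict_space borel pos_group \<Otimes>\<^sub>M E \<rightarrow>\<^sub>M E \<and>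
     (\<forall>x\<in>space E. S 1 x = x) \<and>
     (\<forall>r\<in>pos_group. \<forall>s\<in>pos_group. \<forall>x\<in>space E. S r (S s x) = S (r * s) x)"

definition homogeneous ::
    "'e measure \<Rightarrow> (real ^ 'q \<Rightarrow> 'e \<Rightarrow> 'e) \<Rightarrow> real ^ 'q \<Rightarrow> 'e measure \<Rightarrow> bool" where
  "homogeneous E S \<alpha> \<nu> \<longleftrightarrow>
     (\<forall>r\<in>pos_group. \<forall>A\<in>sets E.
        emeasure \<nu> (S r ` A) = ennreal (inverse (character \<alpha> r)) * emeasure \<nu> A)"

definition sigma_finite_homogeneous ::
    "'e measure \<Rightarrow> (real ^ 'q \<Rightarrow> 'e \<Rightarrow> 'e) \<Rightarrow> real ^ 'q \<Rightarrow> 'e measure set" where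
  "sigma_finite_homogeneous E S \<alpha> =
     {\<nu>. sets \<nu> = sets E \<and> emeasure \<nu> (space E) \<noteq> 0 \<and> sigma_finite_measure \<nu> \<and>
          homogeneous E S \<alpha> \<nu>}"

definition random_element :: "'e measure \<Rightarrow> 'p measure \<Rightarrow> ('p \<Rightarrow> 'e) \<Rightarrow> bool" where
  "random_element E P Z \<longleftrightarrow> prob_space P \<and> Z \<in> P \<rightarrow>\<^sub>M E"

definition orbit_kernel ::
    "(real ^ 'q \<Rightarrow> 'e \<Rightarrow> 'e) \<Rightarrow> real ^ 'q \<Rightarrow> 'e set \<Rightarrow> 'e \<Rightarrow> ennreal" where
  "orbit_kernel S \<alpha> A x = (\<integral>\<^sup>+r. indicator A (S r x) \<partial>theta_measure \<alpha>)"

text \<open>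
  \<open>measure_of\<close> turns a set function into a measure, and into the zero measure if the set function
  is not countably additive. The lemmas \<open>emeasure_nu_of\<close>, \<open>emeasure_mu_of\<close> and
  \<open>emeasure_gauge_profile\<close> at the end show that this does not happen here.
\<close>

definition nu_of ::
    "'e measure \<Rightarrow> (real ^ 'q \<Rightarrow> 'e \<Rightarrow> 'e) \<Rightarrow> real ^ 'q \<Rightarrow> 'p measure \<Rightarrow> ('p \<Rightarrow> 'e)
      \<Rightarrow> 'e measure" where
  "nu_of E S \<alpha> P Z =
     measure_of (space E) (sets E)
       (\<lambda>A. \<integral>\<^sup>+\<omega>. (\<integral>\<^sup>+r. indicator A (S r (Z \<omega>)) \<partial>theta_measure \<alpha>) \<partial>P)"

definition stochastic_representer ::
    "'e measure \<Rightarrow> (real ^ 'q \<Rightarrow> 'e \<Rightarrow> 'e) \<Rightarrow> real ^ 'q \<Rightarrow> 'e measure \<Rightarrow> 'p measure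
      \<Rightarrow> ('p \<Rightarrow> 'e) \<Rightarrow> bool" where
  "stochastic_representer E S \<alpha> \<nu> P Z \<longleftrightarrow>
     random_element E P Z \<and> \<nu> = nu_of E S \<alpha> P Z"

definition product_gauge ::
    "'e measure \<Rightarrow> (real ^ 'q \<Rightarrow> 'e \<Rightarrow> 'e) \<Rightarrow> ('e \<Rightarrow> real ^ 'q) \<Rightarrow> bool" where
  "product_gauge E S \<tau> \<longleftrightarrow>
     \<tau> \<in> E \<rightarrow>\<^sub>M borel \<and>
     (\<forall>x\<in>space E. \<forall>i. 0 \<le> \<tau> x $ i) \<and>
     (\<forall>r\<in>pos_group. \<forall>x\<in>space E. \<tau> (S r x) = r * \<tau> x)"

definition gauge_domain :: "'e measure \<Rightarrow> ('e \<Rightarrow> real ^ 'q) \<Rightarrow> 'e set" where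
  "gauge_domain E \<tau> = {x \<in> space E. \<forall>i. 0 < \<tau> x $ i}"

definition admissible :: "'e measure \<Rightarrow> ('e \<Rightarrow> real ^ 'q) \<Rightarrow> 'e measure \<Rightarrow> bool" where
  "admissible E \<tau> \<nu> \<longleftrightarrow> emeasure \<nu> (space E - gauge_domain E \<tau>) = 0"

definition gauge_section :: "'e measure \<Rightarrow> ('e \<Rightarrow> real ^ 'q) \<Rightarrow> 'e set" where
  "gauge_section E \<tau> = {x \<in> gauge_domain E \<tau>. \<tau> x = 1}"

definition gauge_proj ::
    "'e measure \<Rightarrow> (real ^ 'q \<Rightarrow> 'e \<Rightarrow> 'e) \<Rightarrow> ('e \<Rightarrow> real ^ 'q) \<Rightarrow> 'e \<Rightarrow> 'e \<Rightarrow> 'e" where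
  "gauge_proj E S \<tau> w x =
     (if x \<in> gauge_domain E \<tau> then S (vec_inverse (\<tau> x)) x else w)"

definition unit_cell :: "(real ^ 'q) set" where
  "unit_cell = {r. \<forall>i. 1 < r $ i \<and> r $ i \<le> 2}"

definition gauge_weight :: "real ^ 'q \<Rightarrow> ('e \<Rightarrow> real ^ 'q) \<Rightarrow> 'e \<Rightarrow> real" where
  "gauge_weight \<alpha> \<tau> x = inverse (measure (haar_measure \<alpha>) unit_cell) * indicator unit_cell (\<tau> x)"

definition gauge_profile ::
    "'e measure \<Rightarrow> (real ^ 'q \<Rightarrow> 'e \<Rightarrow> 'e) \<Rightarrow> real ^ 'q \<Rightarrow> ('e \<Rightarrow> real ^ 'q) \<Rightarrow> 'e \<Rightarrow> 'e measure
      \<Rightarrow> 'e measure" where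
  "gauge_profile E S \<alpha> \<tau> w \<nu> =
     measure_of (space (restrict_space E (gauge_section E \<tau>)))
       (sets (restrict_space E (gauge_section E \<tau>)))
       (\<lambda>D. \<integral>\<^sup>+x\<in>gauge_domain E \<tau>. ennreal (character \<alpha> (\<tau> x) * gauge_weight \<alpha> \<tau> x) *
              indicator D (gauge_proj E S \<tau> w x) \<partial>\<nu>)"

definition mu_of ::
    "'e measure \<Rightarrow> (real ^ 'q \<Rightarrow> 'e \<Rightarrow> 'e) \<Rightarrow> real ^ 'q \<Rightarrow> ('e \<Rightarrow> real ^ 'q) \<Rightarrow> 'e \<Rightarrow> 'p measure
      \<Rightarrow> ('p \<Rightarrow> 'e) \<Rightarrow> 'e measure" where
  "mu_of E S \<alpha> \<tau> w P Z =
     measure_of (space (restrict_space E (gauge_section E \<tau>)))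
       (sets (restrict_space E (gauge_section E \<tau>)))
       (\<lambda>D. \<integral>\<^sup>+\<omega>. ennreal (character \<alpha> (\<tau> (Z \<omega>))) *
              indicator D (gauge_proj E S \<tau> w (Z \<omega>)) \<partial>P)"

definition concentrated_on :: "'p measure \<Rightarrow> ('p \<Rightarrow> 'e) \<Rightarrow> 'e set \<Rightarrow> bool" where
  "concentrated_on P Z B \<longleftrightarrow> measure P {\<omega> \<in> space P. Z \<omega> \<in> B} = 1"


lemma emeasure_measure_of_kernel:
  fixes k :: "'x \<Rightarrow> 'e set \<Rightarrow> ennreal"
  assumes meas: "\<And>A. A \<in> sets N \<Longrightarrow> (\<lambda>x. k x A) \<in> borel_measurable Q"
    and empty: "\<And>x. k x {} = 0"
    and add: "\<And>x F. range F \<subseteq> sets N \<Longrightarrow> disjoint_family F \<Longrightarrow> x \<in> space Q \<Longrightarrow>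
      k x (\<Union>(range F)) = (\<Sum>n. k x (F (n :: nat)))"
    and A: "A \<in> sets N"
  shows "emeasure (measure_of (space N) (sets N) (\<lambda>A. \<integral>\<^sup>+x. k x A \<partial>Q)) A = (\<integral>\<^sup>+x. k x A \<partial>Q)"
proof (rule emeasure_measure_of_sigma)
  show "sigma_algebra (space N) (sets N)" ..
  show "positive (sets N) (\<lambda>A. \<integral>\<^sup>+x. k x A \<partial>Q)"
    by (simp add: positive_def empty)
  show "countably_additive (sets N) (\<lambda>A. \<integral>\<^sup>+x. k x A \<partial>Q)"
  proof (rule countably_additiveI)
    fix F :: "nat \<Rightarrow> 'e set"
    assume F: "range F \<subseteq> sets N" "disjoint_family F"
    have "(\<Sum>n. \<integral>\<^sup>+x. k x (F n) \<partial>Q) = (\<integral>\<^sup>+x. (\<Sum>n. k x (F n)) \<partial>Q)"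
      using F by (intro nn_integral_suminf[symmetric] meas) auto
    also have "\<dots> = (\<integral>\<^sup>+x. k x (\<Union>(range F)) \<partial>Q)"
      by (intro nn_integral_cong) (simp add: add[OF F])
    finally show "(\<Sum>n. \<integral>\<^sup>+x. k x (F n) \<partial>Q) = (\<integral>\<^sup>+x. k x (\<Union>(range F)) \<partial>Q)" .
  qed
qed (rule A)

lemma pos_group_sets [measurable]: "(pos_group :: (real ^ 'q) set) \<in> sets borel"
  unfolding pos_group_def by measurable

lemma sets_theta_measure:
  "sets (theta_measure \<alpha>) = sets (restrict_space borel (pos_group :: (real ^ 'q) set))"
  unfolding theta_measure_def by (simp add: sets_restrict_space)

lemma space_theta_measure: "space (theta_measure (\<alpha> :: real ^ 'q)) = pos_group"
  unfolding theta_measure_def by (simp add: space_restrict_space)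

lemma sigma_finite_theta_measure: "sigma_finite_measure (theta_measure (\<alpha> :: real ^ 'q))"
proof -
  interpret R: sigma_finite_measure "restrict_space lborel (pos_group :: (real ^ 'q) set)"
    by (rule sigma_finite_measure_restrict_space) (auto intro: lborel.sigma_finite_measure_axioms)
  have m: "(\<lambda>r :: real ^ 'q. ennreal (\<Prod>i\<in>UNIV. \<alpha> $ i * r $ i powr (- \<alpha> $ i - 1)))
      \<in> borel_measurable (restrict_space lborel pos_group)"
    by (rule measurable_restrict_space1) measurable
  show ?thesis
    unfolding theta_measure_def by (subst R.sigma_finite_iff_density_finite[OF m]) simp
qed

lemma gauge_domain_sets:
  assumes "product_gauge E S \<tau>"
  shows "gauge_domain E \<tau> \<in> sets E"
proof -
  have [measurable]: "\<tau> \<in> E \<rightarrow>\<^sub>M borel"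
    using assms by (simp add: product_gauge_def)
  show ?thesis
    unfolding gauge_domain_def by measurable
qed

lemma gauge_section_sets:
  assumes "product_gauge E S \<tau>"
  shows "gauge_section E \<tau> \<in> sets E"
proof -
  have [measurable]: "\<tau> \<in> E \<rightarrow>\<^sub>M borel" "gauge_domain E \<tau> \<in> sets E"
    using assms gauge_domain_sets by (auto simp: product_gauge_def)
  have "gauge_section E \<tau> = gauge_domain E \<tau> \<inter> {x \<in> space E. \<tau> x = 1}"
    by (auto simp: gauge_section_def gauge_domain_def)
  then show ?thesis
    by simp
qed

lemma character_measurable [measurable]: "character \<alpha> \<in> borel_measurable borel"
  unfolding character_def by measurable

lemma unit_cell_sets [measurable]: "(unit_cell :: (real ^ 'q) set) \<in> sets borel"
  unfolding unit_cell_def by measurable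

lemma gauge_proj_measurable:
  assumes act: "measurable_action E S" and gauge: "product_gauge E S \<tau>"
    and w: "w \<in> gauge_section E \<tau>"
  shows "gauge_proj E S \<tau> w \<in> E \<rightarrow>\<^sub>M restrict_space E (gauge_section E \<tau>)"
proof -
  let ?D = "gauge_domain E \<tau>"
  let ?G = "pos_group :: (real ^ 'q) set"
  have tau [measurable]: "\<tau> \<in> E \<rightarrow>\<^sub>M borel"
    using gauge by (simp add: product_gauge_def)
  have D [measurable]: "?D \<in> sets E"
    by (rule gauge_domain_sets[OF gauge])
  have S: "(\<lambda>(r, x). S r x) \<in> restrict_space borel ?G \<Otimes>\<^sub>M E \<rightarrow>\<^sub>M E"
    using act by (simp add: measurable_action_def)
  have tau_i: "(\<lambda>x. \<tau> x $ i) \<in> borel_measurable E" for i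
    by (rule measurable_compose[OF tau])
      (intro borel_measurable_continuous_onI continuous_intros)
  have inv_m: "(\<lambda>x. vec_inverse (\<tau> x)) \<in> E \<rightarrow>\<^sub>M borel"
    unfolding vec_inverse_def
    by (subst borel_measurable_euclidean_space)
      (auto simp: Basis_vec_def inner_axis intro!: borel_measurable_inverse tau_i)
  have inv_G: "vec_inverse (\<tau> x) \<in> ?G" if "x \<in> ?D" for x
    using that by (auto simp: vec_inverse_def pos_group_def gauge_domain_def)
  have "(\<lambda>x. (vec_inverse (\<tau> x), x)) \<in> restrict_space E ?D \<rightarrow>\<^sub>M restrict_space borel ?G \<Otimes>\<^sub>M E"
    by (intro measurable_Pair measurable_restrict_space2 measurable_restrict_space1 inv_m)
      (auto simp: space_restrict_space inv_G)
  from measurable_compose[OF this S]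
  have "(\<lambda>x. S (vec_inverse (\<tau> x)) x) \<in> restrict_space E ?D \<rightarrow>\<^sub>M E"
    by simp
  moreover have wE: "w \<in> space E"
    using w by (auto simp: gauge_section_def gauge_domain_def)
  ultimately have m: "gauge_proj E S \<tau> w \<in> E \<rightarrow>\<^sub>M E"
    unfolding gauge_proj_def
    by (subst measurable_If_restrict_space_iff) (auto intro!: measurable_restrict_space1)
  have "gauge_proj E S \<tau> w x \<in> gauge_section E \<tau>" if x: "x \<in> space E" for x
  proof (cases "x \<in> ?D")
    case True
    have "\<tau> (S (vec_inverse (\<tau> x)) x) = vec_inverse (\<tau> x) * \<tau> x"
      using gauge inv_G[OF True] x by (simp add: product_gauge_def)
    also have "\<dots> = 1"
      using True
      by (auto simp: vec_eq_iff vec_inverse_def gauge_domain_def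
        intro!: left_inverse less_imp_neq[THEN not_sym])
    finally show ?thesis
      using True x measurable_space[OF m x]
      by (auto simp: gauge_proj_def gauge_section_def gauge_domain_def)
  qed (simp add: gauge_proj_def w)
  with m show ?thesis
    by (intro measurable_restrict_space2) auto
qed

lemma emeasure_nu_of:
  fixes S :: "real ^ 'q \<Rightarrow> 'e \<Rightarrow> 'e"
  assumes act: "measurable_action E S" and Z: "random_element E P Z" and A: "A \<in> sets E"
  shows "emeasure (nu_of E S \<alpha> P Z) A =
    (\<integral>\<^sup>+\<omega>. (\<integral>\<^sup>+r. indicator A (S r (Z \<omega>)) \<partial>theta_measure \<alpha>) \<partial>P)"
  unfolding nu_of_def
proof (rule emeasure_measure_of_kernel)
  interpret T: sigma_finite_measure "theta_measure \<alpha>"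
    by (rule sigma_finite_theta_measure)
  have Zm [measurable]: "Z \<in> P \<rightarrow>\<^sub>M E"
    using Z by (simp add: random_element_def)
  have "(\<lambda>(r, x). S r x) \<in> theta_measure \<alpha> \<Otimes>\<^sub>M E \<rightarrow>\<^sub>M E"
    using act unfolding measurable_action_def
    by (simp add: measurable_cong_sets[OF sets_pair_measure_cong[OF sets_theta_measure refl] refl])
  moreover have "(\<lambda>(\<omega>, r). (r, Z \<omega>)) \<in> P \<Otimes>\<^sub>M theta_measure \<alpha> \<rightarrow>\<^sub>M theta_measure \<alpha> \<Otimes>\<^sub>M E"
    by measurable
  ultimately have
    "(\<lambda>p. case (case p of (\<omega>, r) \<Rightarrow> (r, Z \<omega>)) of (r, x) \<Rightarrow> S r x)
      \<in> P \<Otimes>\<^sub>M theta_measure \<alpha> \<rightarrow>\<^sub>M E"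
    by (rule measurable_compose[rotated])
  then have m [measurable]:
    "(\<lambda>(\<omega>, r). S r (Z \<omega>)) \<in> P \<Otimes>\<^sub>M theta_measure \<alpha> \<rightarrow>\<^sub>M E"
    by (simp add: case_prod_beta')
  show "(\<lambda>\<omega>. \<integral>\<^sup>+r. indicator B (S r (Z \<omega>)) \<partial>theta_measure \<alpha>) \<in> borel_measurable P"
    if [measurable]: "B \<in> sets E" for B
    by measurable
  show "(\<integral>\<^sup>+r. indicator (\<Union>(range F)) (S r (Z \<omega>)) \<partial>theta_measure \<alpha>) =
      (\<Sum>n. \<integral>\<^sup>+r. indicator (F (n :: nat)) (S r (Z \<omega>)) \<partial>theta_measure \<alpha>)"
    if F: "range F \<subseteq> sets E" "disjoint_family F" and \<omega> [measurable]: "\<omega> \<in> space P" for \<omega> F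
  proof -
    have [measurable]: "F n \<in> sets E" for n
      using F by auto
    have "(\<integral>\<^sup>+r. indicator (\<Union>(range F)) (S r (Z \<omega>)) \<partial>theta_measure \<alpha>) =
        (\<integral>\<^sup>+r. (\<Sum>n. indicator (F n) (S r (Z \<omega>))) \<partial>theta_measure \<alpha>)"
      by (simp add: suminf_indicator[OF F(2)])
    also have "\<dots> = (\<Sum>n. \<integral>\<^sup>+r. indicator (F n) (S r (Z \<omega>)) \<partial>theta_measure \<alpha>)"
      by (rule nn_integral_suminf) measurable
    finally show ?thesis .
  qed
qed (use A in auto)

lemma emeasure_mu_of:
  assumes act: "measurable_action E S" and gauge: "product_gauge E S \<tau>"
    and w: "w \<in> gauge_section E \<tau>" and Z: "random_element E P Z"
    and D: "D \<in> sets (restrict_space E (gauge_section E \<tau>))"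
  shows "emeasure (mu_of E S \<alpha> \<tau> w P Z) D =
    (\<integral>\<^sup>+\<omega>. ennreal (character \<alpha> (\<tau> (Z \<omega>))) * indicator D (gauge_proj E S \<tau> w (Z \<omega>)) \<partial>P)"
  unfolding mu_of_def
proof (rule emeasure_measure_of_kernel)
  have [measurable]: "Z \<in> P \<rightarrow>\<^sub>M E" "\<tau> \<in> E \<rightarrow>\<^sub>M borel"
    using Z gauge by (auto simp: random_element_def product_gauge_def)
  note [measurable] = gauge_proj_measurable[OF act gauge w]
  show "(\<lambda>\<omega>. ennreal (character \<alpha> (\<tau> (Z \<omega>))) * indicator B (gauge_proj E S \<tau> w (Z \<omega>)))
      \<in> borel_measurable P"
    if [measurable]: "B \<in> sets (restrict_space E (gauge_section E \<tau>))" for B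
    by measurable
qed (use D in \<open>auto simp: suminf_indicator ennreal_suminf_cmult\<close>)

lemma emeasure_gauge_profile:
  assumes act: "measurable_action E S" and gauge: "product_gauge E S \<tau>"
    and w: "w \<in> gauge_section E \<tau>" and \<nu>: "sets \<nu> = sets E"
    and D: "D \<in> sets (restrict_space E (gauge_section E \<tau>))"
  shows "emeasure (gauge_profile E S \<alpha> \<tau> w \<nu>) D =
    (\<integral>\<^sup>+x\<in>gauge_domain E \<tau>. ennreal (character \<alpha> (\<tau> x) * gauge_weight \<alpha> \<tau> x) *
       indicator D (gauge_proj E S \<tau> w x) \<partial>\<nu>)"
  unfolding gauge_profile_def
proof (rule emeasure_measure_of_kernel)
  have [measurable]: "\<tau> \<in> \<nu> \<rightarrow>\<^sub>M borel" "gauge_domain E \<tau> \<in> sets \<nu>"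
      "gauge_proj E S \<tau> w \<in> \<nu> \<rightarrow>\<^sub>M restrict_space E (gauge_section E \<tau>)"
    using gauge gauge_domain_sets[OF gauge] gauge_proj_measurable[OF act gauge w]
    by (auto simp: product_gauge_def \<nu> measurable_cong_sets[OF \<nu> refl])
  show "(\<lambda>x. ennreal (character \<alpha> (\<tau> x) * gauge_weight \<alpha> \<tau> x) *
      indicator B (gauge_proj E S \<tau> w x) * indicator (gauge_domain E \<tau>) x) \<in> borel_measurable \<nu>"
    if [measurable]: "B \<in> sets (restrict_space E (gauge_section E \<tau>))" for B
    unfolding gauge_weight_def by measurable
qed (use D in \<open>auto simp: suminf_indicator ennreal_suminf_cmult ennreal_suminf_multc\<close>)

end

theory Submission
  imports Defs
begin

text \<open>
  Every \<open>x\<close> in the gauge domain decomposes as \<open>x = S (\<tau> x) y\<close>, with radius \<open>\<tau> x\<close> and with an angle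
  \<open>y\<close> in the gauge section that is constant along orbits (\<open>action_proj\<close>, \<open>proj_action\<close>). The measure
  \<open>theta_measure\<close> is multiplied by \<open>character \<alpha> s\<close> under scaling by \<open>s\<close>, so the orbit kernel at \<open>x\<close>
  is \<open>character \<alpha> (\<tau> x)\<close> times the kernel at the angle (\<open>kernel_polar\<close>). Taking expectations
  expresses \<open>nu_of\<close> through \<open>mu_of\<close> (\<open>emeasure_nu_of_disintegration\<close>).

  Conversely, \<open>mu_of\<close> is the profile of \<open>nu_of\<close> (\<open>mu_of_eq_profile_nu_of\<close>). The reason is that
  the gauge weight, averaged along an orbit against \<open>haar_measure \<alpha>\<close>, is 1: it is the indicator of
  a cell of gauges divided by the Haar mass of that cell. So each of the two measures of a random
  element concentrated on the domain determines the other, which gives the last equivalence.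

  For the comparison with a given \<open>\<nu>\<close>, it remains to know that \<open>\<nu>\<close>, too, is recovered from its
  profile by integrating the kernel (\<open>emeasure_eq_kernel_profile\<close>). There Tonelli's theorem and
  homogeneity reduce the claim to the average of the weight along the inverted orbit
  \<open>S (vec_inverse r) x\<close>. That average is 1 as well, because dyadic boxes have the same Haar mass
  wherever they lie and whichever ends they contain (\<open>haar_dyadic_box\<close>).

  A representer cannot leave the gauge domain with positive probability, since the complement is
  invariant and would then receive positive mass from \<open>nu_of\<close>, whereas admissibility makes it a
  null set (\<open>representer_concentrated\<close>).
\<close>

section \<open>Lebesgue measure in coordinates\<close>

lemma bij_betw_axis_Basis: "bij_betw (\<lambda>i. axis i 1) UNIV (Basis :: (real ^ 'q) set)"
  by (auto simp: bij_betw_def inj_on_def axis_eq_axis Basis_vec_def)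

lemma prod_Basis_vec: "(\<Prod>b\<in>(Basis :: (real ^ 'q) set). f b) = (\<Prod>i\<in>UNIV. f (axis i 1))"
  using prod.reindex_bij_betw[OF bij_betw_axis_Basis, of f] by simp

lemma nn_integral_lborel_vec_prod:
  fixes f :: "'q::finite \<Rightarrow> real \<Rightarrow> ennreal"
  assumes "\<And>i. f i \<in> borel_measurable borel"
  shows "(\<integral>\<^sup>+r. (\<Prod>i\<in>UNIV. f i (r $ i)) \<partial>(lborel :: (real ^ 'q) measure)) =
    (\<Prod>i\<in>UNIV. \<integral>\<^sup>+t. f i t \<partial>lborel)"
proof -
  have "(\<integral>\<^sup>+r. (\<Prod>b\<in>Basis. f (axis_index b) (r \<bullet> b)) \<partial>(lborel :: (real ^ 'q) measure)) =
      (\<Prod>b\<in>(Basis :: (real ^ 'q) set). \<integral>\<^sup>+t. f (axis_index b) t \<partial>lborel)"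
    by (rule nn_integral_lborel_prod) (use assms in auto)
  then show ?thesis
    by (simp add: prod_Basis_vec inner_axis axis_index_axis)
qed

lemma lborel_vec_scale:
  fixes s :: "real ^ 'q"
  assumes "\<And>i. 0 < s $ i"
  shows "lborel = density (distr lborel borel (\<lambda>r. r * s)) (\<lambda>_. ennreal (\<Prod>i\<in>UNIV. s $ i))"
proof -
  have *: "(\<Sum>b\<in>Basis. (s \<bullet> b * (r \<bullet> b)) *\<^sub>R b) = r * s" for r :: "real ^ 'q"
  proof -
    have "(\<Sum>b\<in>Basis. (s \<bullet> b * (r \<bullet> b)) *\<^sub>R b) =
        (\<Sum>i\<in>UNIV. (s $ i * r $ i) *\<^sub>R (axis i 1 :: real ^ 'q))"
      using sum.reindex_bij_betw[OF bij_betw_axis_Basis,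
          of "\<lambda>b. (s \<bullet> b * (r \<bullet> b)) *\<^sub>R b"]
      by (simp add: inner_axis)
    also have "\<dots> = r * s"
      by (simp add: vec_eq_iff axis_def if_distrib sum.delta cong: if_cong)
    finally show ?thesis .
  qed
  have "lborel = density (distr lborel borel (\<lambda>r. 0 + (\<Sum>b\<in>Basis. (s \<bullet> b * (r \<bullet> b)) *\<^sub>R b)))
      (\<lambda>_. ennreal (\<Prod>b\<in>Basis. \<bar>s \<bullet> b\<bar>))"
    by (rule lborel_affine_euclidean) (use assms in \<open>auto simp: Basis_vec_def inner_axis less_imp_neq[THEN not_sym]\<close>)
  moreover have "\<bar>s $ i\<bar> = s $ i" for i
    using assms[of i] by simp
  ultimately show ?thesis
    by (simp add: * prod_Basis_vec inner_axis)
qed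

section \<open>The group of positive vectors and its character\<close>

lemma vec_nth_measurable:
  fixes f :: "'a \<Rightarrow> real ^ 'q"
  assumes "f \<in> borel_measurable M"
  shows "(\<lambda>x. f x $ i) \<in> borel_measurable M"
  by (rule measurable_compose[OF assms])
    (intro borel_measurable_continuous_onI continuous_intros)

lemma vec_times_measurable:
  fixes f g :: "'a \<Rightarrow> real ^ 'q"
  assumes [measurable]: "f \<in> borel_measurable M" "g \<in> borel_measurable M"
  shows "(\<lambda>x. f x * g x) \<in> borel_measurable M"
proof -
  have [measurable]: "(\<lambda>x. f x $ i) \<in> borel_measurable M" "(\<lambda>x. g x $ i) \<in> borel_measurable M" for i
    by (rule vec_nth_measurable, measurable)+
  show ?thesis
    by (subst borel_measurable_euclidean_space) (auto simp: Basis_vec_def inner_axis)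
qed

lemma vec_inverse_measurable:
  fixes f :: "'a \<Rightarrow> real ^ 'q"
  assumes [measurable]: "f \<in> borel_measurable M"
  shows "(\<lambda>x. vec_inverse (f x)) \<in> borel_measurable M"
proof -
  have [measurable]: "(\<lambda>x. f x $ i) \<in> borel_measurable M" for i
    by (rule vec_nth_measurable, measurable)
  show ?thesis
    unfolding vec_inverse_def
    by (subst borel_measurable_euclidean_space) (auto simp: Basis_vec_def inner_axis)
qed

lemma character_pos:
  assumes "r \<in> pos_group"
  shows "0 < character \<alpha> r"
proof -
  have "0 < r $ i powr \<alpha> $ i" for i
    using assms by (simp add: pos_group_def less_imp_neq[THEN not_sym])
  then show ?thesis
    by (simp add: character_def prod_pos)
qed

lemma character_mult:
  "r \<in> pos_group \<Longrightarrow> s \<in> pos_group \<Longrightarrow> character \<alpha> (r * s) = character \<alpha> r * character \<alpha> s"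
  by (simp add: character_def pos_group_def powr_mult prod.distrib less_imp_le)

lemma vec_inverse_pos_group: "r \<in> pos_group \<Longrightarrow> vec_inverse r \<in> pos_group"
  by (simp add: vec_inverse_def pos_group_def)

lemma mult_pos_group: "r \<in> pos_group \<Longrightarrow> s \<in> pos_group \<Longrightarrow> r * s \<in> pos_group"
  by (simp add: pos_group_def)

lemma vec_inverse_mult:
  assumes "r \<in> pos_group"
  shows "vec_inverse r * r = 1" "r * vec_inverse r = 1"
proof -
  have "r $ i \<noteq> 0" for i
    using assms by (simp add: pos_group_def less_imp_neq[THEN not_sym])
  then show "vec_inverse r * r = 1" "r * vec_inverse r = 1"
    by (simp_all add: vec_eq_iff vec_inverse_def)
qed

lemma character_vec_inverse:
  "r \<in> pos_group \<Longrightarrow> character \<alpha> (vec_inverse r) = inverse (character \<alpha> r)"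
  by (simp add: character_def vec_inverse_def pos_group_def inverse_powr prod_inversef[unfolded o_def] less_imp_le)

section \<open>The measures on the group\<close>

lemma nn_integral_theta:
  fixes \<alpha> :: "real ^ 'q"
  assumes "f \<in> borel_measurable (theta_measure \<alpha>)"
  shows "(\<integral>\<^sup>+r. f r \<partial>theta_measure \<alpha>) =
    (\<integral>\<^sup>+r. ennreal (\<Prod>i\<in>UNIV. \<alpha> $ i * r $ i powr (- \<alpha> $ i - 1)) * f r * indicator pos_group r
      \<partial>lborel)"
proof -
  have m: "(\<lambda>r :: real ^ 'q. ennreal (\<Prod>i\<in>UNIV. \<alpha> $ i * r $ i powr (- \<alpha> $ i - 1)))
      \<in> borel_measurable (restrict_space lborel pos_group)"
    by (rule measurable_restrict_space1) measurable
  from assms have "f \<in> borel_measurable (restrict_space lborel pos_group)"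
    by (simp add: theta_measure_def)
  then show ?thesis
    by (simp add: theta_measure_def nn_integral_density[OF m] nn_integral_restrict_space)
qed

text \<open>
  \<open>theta_measure\<close> is relatively invariant: in one coordinate the substitution \<open>u = r s\<close> turns
  \<open>r powr (- a - 1) dr\<close> into \<open>s powr a * u powr (- a - 1) du\<close>, and the factors \<open>s powr a\<close> multiply
  to the character.
\<close>
lemma nn_integral_theta_scale:
  fixes \<alpha> s :: "real ^ 'q"
  assumes f: "f \<in> borel_measurable (theta_measure \<alpha>)" and s: "s \<in> pos_group"
    and \<alpha>: "\<forall>i. 0 < \<alpha> $ i"
  shows "(\<integral>\<^sup>+r. f (r * s) \<partial>theta_measure \<alpha>) = ennreal (character \<alpha> s) * (\<integral>\<^sup>+r. f r \<partial>theta_measure \<alpha>)"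
proof -
  let ?\<rho> = "\<lambda>r. \<Prod>i\<in>UNIV. \<alpha> $ i * r $ i powr (- \<alpha> $ i - 1)"
  let ?F = "\<lambda>r. ennreal (?\<rho> r) * f r * indicator pos_group r"
  let ?J = "\<Prod>i\<in>UNIV. s $ i"
  have sp: "0 < s $ i" for i
    using s by (simp add: pos_group_def)
  have fB: "f \<in> borel_measurable (restrict_space borel pos_group)"
    using f by (simp add: measurable_cong_sets[OF sets_theta_measure refl])
  have "(\<lambda>r. f r * indicator pos_group r) \<in> borel_measurable borel"
    using fB by (subst (asm) borel_measurable_restrict_space_iff_ennreal) auto
  then have F [measurable]: "?F \<in> borel_measurable borel"
    by (simp add: mult.assoc)
  have scale [measurable]: "(\<lambda>r. r * s) \<in> borel \<rightarrow>\<^sub>M borel"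
    by (rule vec_times_measurable) auto
  have scale_theta: "(\<lambda>r. r * s) \<in> theta_measure \<alpha> \<rightarrow>\<^sub>M theta_measure \<alpha>"
    unfolding measurable_cong_sets[OF sets_theta_measure sets_theta_measure]
    by (intro measurable_restrict_space2 measurable_restrict_space1 scale)
      (auto simp: space_restrict_space mult_pos_group s)
  \<comment> \<open>of the powers of \<open>s\<close> in the density, \<open>?J\<close> cancels the exponent \<open>- 1\<close>, the character \<open>- \<alpha>\<close>\<close>
  have rho_scale: "?J * ?\<rho> (r * s) * character \<alpha> s = ?\<rho> r" if r: "r \<in> pos_group" for r
  proof -
    have "s $ i * (\<alpha> $ i * (r $ i * s $ i) powr (- \<alpha> $ i - 1)) * s $ i powr \<alpha> $ i =
        \<alpha> $ i * r $ i powr (- \<alpha> $ i - 1)" for i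
    proof -
      have "s $ i powr 1 * s $ i powr (- \<alpha> $ i - 1) * s $ i powr \<alpha> $ i = 1"
        using sp[of i] by (simp only: powr_add[symmetric]) simp
      then have "s $ i * s $ i powr (- \<alpha> $ i - 1) * s $ i powr \<alpha> $ i = 1"
        using sp[of i] by simp
      then show ?thesis
        using sp[of i] r by (simp add: pos_group_def powr_mult less_imp_le mult.assoc mult.left_commute)
    qed
    then show ?thesis
      by (simp only: character_def prod.distrib[symmetric] vector_mult_component)
  qed
  have "(\<integral>\<^sup>+r. f r \<partial>theta_measure \<alpha>) = (\<integral>\<^sup>+r. ?F r \<partial>lborel)"
    by (rule nn_integral_theta[OF f])
  also have "\<dots> = (\<integral>\<^sup>+r. ennreal ?J * ?F (r * s) \<partial>lborel)"
    by (subst lborel_vec_scale[OF sp]) (simp add: nn_integral_density nn_integral_distr)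
  finally have eq: "(\<integral>\<^sup>+r. f r \<partial>theta_measure \<alpha>) = (\<integral>\<^sup>+r. ennreal ?J * ?F (r * s) \<partial>lborel)" .
  have [measurable]: "(\<lambda>r. ?F (r * s)) \<in> borel_measurable lborel"
    using measurable_compose[OF scale F] by simp
  have "ennreal (character \<alpha> s) * (\<integral>\<^sup>+r. f r \<partial>theta_measure \<alpha>) =
      (\<integral>\<^sup>+r. ennreal (character \<alpha> s) * (ennreal ?J * ?F (r * s)) \<partial>lborel)"
    unfolding eq by (rule nn_integral_cmult[symmetric]) measurable
  also have "\<dots> = (\<integral>\<^sup>+r. ennreal (?\<rho> r) * f (r * s) * indicator pos_group r \<partial>lborel)"
  proof (intro nn_integral_cong)
    fix r :: "real ^ 'q"
    show "ennreal (character \<alpha> s) * (ennreal ?J * ?F (r * s)) =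
      ennreal (?\<rho> r) * f (r * s) * indicator pos_group r"
    proof (cases "r \<in> pos_group")
      case True
      have J: "0 \<le> ?J" and rho: "0 \<le> ?\<rho> (r * s)"
        using sp \<alpha> by (auto intro!: prod_nonneg mult_nonneg_nonneg simp: less_imp_le)
      have "ennreal (?\<rho> r) = ennreal (character \<alpha> s) * (ennreal ?J * ennreal (?\<rho> (r * s)))"
        by (subst rho_scale[OF True, symmetric])
          (use J rho in \<open>simp add: ennreal_mult character_pos[OF s, THEN less_imp_le] ac_simps\<close>)
      with True show ?thesis
        by (simp add: mult_pos_group s mult.assoc)
    next
      case False
      then have "r * s \<notin> pos_group"
        using sp by (simp add: pos_group_def zero_less_mult_iff) (meson less_asym)
      with False show ?thesis by simp
    qed
  qed
  also have "\<dots> = (\<integral>\<^sup>+r. f (r * s) \<partial>theta_measure \<alpha>)"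
    by (rule nn_integral_theta[symmetric]) (rule measurable_compose[OF scale_theta f])
  finally show ?thesis ..
qed

text \<open>
  This is the bridge that lets a factor \<open>character \<alpha> r\<close> in an integral against
  \<open>theta_measure\<close> be absorbed, so that the invariant measure appears.
\<close>
lemma haar_eq_density_theta:
  fixes \<alpha> :: "real ^ 'q"
  assumes \<alpha>: "\<forall>i. 0 < \<alpha> $ i"
  shows "haar_measure \<alpha> = density (theta_measure \<alpha>) (\<lambda>r. ennreal (character \<alpha> r))"
proof -
  let ?R = "restrict_space lborel (pos_group :: (real ^ 'q) set)"
  let ?\<rho> = "\<lambda>r. \<Prod>i\<in>UNIV. \<alpha> $ i * r $ i powr (- \<alpha> $ i - 1)"
  have [measurable]: "(\<lambda>r. ennreal (?\<rho> r)) \<in> borel_measurable ?R"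
      "(\<lambda>r. ennreal (character \<alpha> r)) \<in> borel_measurable ?R"
      "(\<lambda>r. ennreal (\<Prod>i\<in>UNIV. \<alpha> $ i / r $ i)) \<in> borel_measurable ?R"
    by (rule measurable_restrict_space1; measurable)+
  have eq: "(\<Prod>i\<in>UNIV. \<alpha> $ i / r $ i) = ?\<rho> r * character \<alpha> r" if "r \<in> pos_group" for r
  proof -
    have "r $ i powr (- \<alpha> $ i - 1) * r $ i powr \<alpha> $ i = inverse (r $ i)" for i
      using that by (simp only: powr_add[symmetric])
        (simp add: pos_group_def powr_minus less_imp_le)
    then show ?thesis
      by (simp only: character_def prod.distrib[symmetric] mult.assoc divide_inverse)
  qed
  have rho: "0 \<le> ?\<rho> r" for r :: "real ^ 'q"
    using \<alpha> by (auto intro!: prod_nonneg mult_nonneg_nonneg simp: less_imp_le)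
  have "density ?R (\<lambda>r. ennreal (\<Prod>i\<in>UNIV. \<alpha> $ i / r $ i)) =
      density ?R (\<lambda>r. ennreal (?\<rho> r) * ennreal (character \<alpha> r))"
  proof (rule density_cong)
    show "AE r in ?R. ennreal (\<Prod>i\<in>UNIV. \<alpha> $ i / r $ i) = ennreal (?\<rho> r) * ennreal (character \<alpha> r)"
    proof (rule AE_I2)
      fix r :: "real ^ 'q" assume "r \<in> space ?R"
      then have "r \<in> pos_group" by (simp add: space_restrict_space)
      then show "ennreal (\<Prod>i\<in>UNIV. \<alpha> $ i / r $ i) = ennreal (?\<rho> r) * ennreal (character \<alpha> r)"
        by (simp only: eq) (rule ennreal_mult[OF rho less_imp_le[OF character_pos]])
    qed
  qed measurable
  then show ?thesis
    unfolding haar_measure_def theta_measure_def by (subst density_density_eq) auto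
qed

text \<open>
  The logarithmic length of a dyadic interval does not depend on its position. The end points are
  left open because multiplying the unit cell and inverting it put the closed end on different sides.
\<close>
lemma nn_integral_inverse_dyadic:
  fixes a c :: real
  assumes "0 < a" "0 < c" "{a<..<2 * a} \<subseteq> J" "J \<subseteq> {a..2 * a}"
  shows "(\<integral>\<^sup>+t. ennreal (c / t) * indicator J t \<partial>lborel) = ennreal (c * ln 2)"
proof -
  have "AE t in lborel. t \<noteq> a \<and> t \<noteq> 2 * a"
    using AE_lborel_singleton[of a] AE_lborel_singleton[of "2 * a"] by eventually_elim auto
  then have "(\<integral>\<^sup>+t. ennreal (c / t) * indicator J t \<partial>lborel) =
      (\<integral>\<^sup>+t. ennreal (c / t) * indicator {a..2 * a} t \<partial>lborel)"
    by (intro nn_integral_cong_AE, eventually_elim)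
      (use assms in \<open>auto simp: indicator_def subset_iff\<close>)
  also have "\<dots> = ennreal (c * ln (2 * a) - c * ln a)"
    using assms
    by (intro nn_integral_FTC_Icc)
      (auto intro!: derivative_eq_intros simp: has_real_derivative_iff_has_vector_derivative[symmetric])
  also have "c * ln (2 * a) - c * ln a = c * ln 2"
    using assms by (simp add: ln_mult algebra_simps)
  finally show ?thesis .
qed

text \<open>
  The mass does not depend on \<open>a\<close>. On dyadic boxes this expresses the invariance of Haar measure under
  multiplication and, as it is free which ends belong to the box, also under inversion.
\<close>
lemma haar_dyadic_box:
  fixes \<alpha> a :: "real ^ 'q" and J :: "'q \<Rightarrow> real set"
  assumes \<alpha>: "\<forall>i. 0 < \<alpha> $ i" and a: "a \<in> pos_group"
    and J: "\<And>i. J i \<in> sets borel" "\<And>i. {a $ i<..<2 * a $ i} \<subseteq> J i" "\<And>i. J i \<subseteq> {a $ i..2 * a $ i}"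
  shows "emeasure (haar_measure \<alpha>) {r. \<forall>i. r $ i \<in> J i} = ennreal (\<Prod>i\<in>UNIV. \<alpha> $ i * ln 2)"
proof -
  let ?B = "{r :: real ^ 'q. \<forall>i. r $ i \<in> J i}"
  have a': "0 < a $ i" for i
    using a by (simp add: pos_group_def)
  have sub: "?B \<subseteq> pos_group"
    using J(3) a' by (fastforce simp: pos_group_def subset_iff intro: less_le_trans)
  have [measurable]: "J i \<in> sets borel" for i
    by (rule J)
  have B [measurable]: "?B \<in> sets borel"
    by measurable
  have [measurable]: "(\<lambda>r :: real ^ 'q. ennreal (\<Prod>i\<in>UNIV. \<alpha> $ i / r $ i))
      \<in> borel_measurable (restrict_space lborel pos_group)"
    by (rule measurable_restrict_space1) measurable
  have "?B \<in> sets (restrict_space lborel pos_group)"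
    using B sub by (auto simp: sets_restrict_space_iff)
  then have "emeasure (haar_measure \<alpha>) ?B =
      (\<integral>\<^sup>+r. ennreal (\<Prod>i\<in>UNIV. \<alpha> $ i / r $ i) * indicator ?B r * indicator pos_group r \<partial>lborel)"
    by (simp add: haar_measure_def emeasure_density nn_integral_restrict_space)
  also have "\<dots> = (\<integral>\<^sup>+r. (\<Prod>i\<in>UNIV. ennreal (\<alpha> $ i / r $ i) * indicator (J i) (r $ i)) \<partial>lborel)"
  proof (intro nn_integral_cong)
    fix r :: "real ^ 'q"
    show "ennreal (\<Prod>i\<in>UNIV. \<alpha> $ i / r $ i) * indicator ?B r * indicator pos_group r =
      (\<Prod>i\<in>UNIV. ennreal (\<alpha> $ i / r $ i) * indicator (J i) (r $ i))"
    proof (cases "r \<in> ?B")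
      case True
      with sub have "r \<in> pos_group" by blast
      then show ?thesis
        using True \<alpha> by (simp add: prod_ennreal pos_group_def less_imp_le)
    next
      case False
      then obtain i where "r $ i \<notin> J i" by blast
      then have "(\<Prod>i\<in>UNIV. ennreal (\<alpha> $ i / r $ i) * indicator (J i) (r $ i)) = 0"
        by (intro prod_zero) (auto intro!: exI[of _ i])
      with False show ?thesis by simp
    qed
  qed
  also have "\<dots> = (\<Prod>i\<in>UNIV. \<integral>\<^sup>+t. ennreal (\<alpha> $ i / t) * indicator (J i) t \<partial>lborel)"
    by (rule nn_integral_lborel_vec_prod) measurable
  also have "\<dots> = (\<Prod>i\<in>UNIV. ennreal (\<alpha> $ i * ln 2))"
    using \<alpha> by (intro prod.cong refl nn_integral_inverse_dyadic[OF a' _ J(2,3)]) auto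
  finally show ?thesis
    using \<alpha> by (simp add: prod_ennreal less_imp_le)
qed

section \<open>Actions with a product gauge\<close>

locale gauged_action =
  fixes E :: "'e measure"
    and S :: "real ^ 'q \<Rightarrow> 'e \<Rightarrow> 'e"
    and \<alpha> :: "real ^ 'q"
    and \<tau> :: "'e \<Rightarrow> real ^ 'q"
    and w :: 'e
  assumes action: "measurable_action E S"
    and exponent_pos: "\<forall>i. 0 < \<alpha> $ i"
    and gauge: "product_gauge E S \<tau>"
    and base_point: "w \<in> gauge_section E \<tau>"
begin

abbreviation \<Sigma> :: "'e measure" where
  "\<Sigma> \<equiv> restrict_space E (gauge_section E \<tau>)"

abbreviation \<pi> :: "'e \<Rightarrow> 'e" where
  "\<pi> \<equiv> gauge_proj E S \<tau> w"

abbreviation K :: "'e set \<Rightarrow> 'e \<Rightarrow> ennreal" where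
  "K \<equiv> orbit_kernel S \<alpha>"

sublocale theta: sigma_finite_measure "theta_measure \<alpha>"
  by (rule sigma_finite_theta_measure)

lemma action_measurable:
  "(\<lambda>(r, x). S r x) \<in> theta_measure \<alpha> \<Otimes>\<^sub>M E \<rightarrow>\<^sub>M E"
  using action unfolding measurable_action_def
  by (simp add: measurable_cong_sets[OF sets_pair_measure_cong[OF sets_theta_measure refl] refl])

lemma action_measurable_compose [measurable (raw)]:
  assumes "f \<in> M \<rightarrow>\<^sub>M theta_measure \<alpha>" "g \<in> M \<rightarrow>\<^sub>M E"
  shows "(\<lambda>x. S (f x) (g x)) \<in> M \<rightarrow>\<^sub>M E"
  using measurable_compose[OF measurable_Pair[OF assms] action_measurable] by simp

lemma vec_inverse_theta [measurable]: "vec_inverse \<in> theta_measure \<alpha> \<rightarrow>\<^sub>M theta_measure \<alpha>"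
  unfolding measurable_cong_sets[OF sets_theta_measure sets_theta_measure]
  by (intro measurable_restrict_space2 measurable_restrict_space1 vec_inverse_measurable)
    (auto simp: space_restrict_space vec_inverse_pos_group)

lemma character_theta [measurable]: "character \<alpha> \<in> borel_measurable (theta_measure \<alpha>)"
  unfolding measurable_cong_sets[OF sets_theta_measure refl]
  by (rule measurable_restrict_space1) measurable

lemma gauge_measurable [measurable]: "\<tau> \<in> borel_measurable E"
  using gauge by (simp add: product_gauge_def)

lemma domain_measurable [measurable]: "gauge_domain E \<tau> \<in> sets E"
  by (rule gauge_domain_sets[OF gauge])

lemma proj_measurable [measurable]: "\<pi> \<in> E \<rightarrow>\<^sub>M \<Sigma>"
  by (rule gauge_proj_measurable[OF action gauge base_point])

lemma weight_measurable [measurable]: "gauge_weight \<alpha> \<tau> \<in> borel_measurable E"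
  unfolding gauge_weight_def by measurable

lemma action_space: "r \<in> pos_group \<Longrightarrow> x \<in> space E \<Longrightarrow> S r x \<in> space E"
  using measurable_space[OF action_measurable, of "(r, x)"]
  by (simp add: space_pair_measure space_theta_measure)

lemma action_mult:
  "r \<in> pos_group \<Longrightarrow> s \<in> pos_group \<Longrightarrow> x \<in> space E \<Longrightarrow> S r (S s x) = S (r * s) x"
  and action_one: "x \<in> space E \<Longrightarrow> S 1 x = x"
  using action by (auto simp: measurable_action_def)

lemma gauge_action: "r \<in> pos_group \<Longrightarrow> x \<in> space E \<Longrightarrow> \<tau> (S r x) = r * \<tau> x"
  using gauge by (simp add: product_gauge_def)

lemma in_domain_iff: "x \<in> gauge_domain E \<tau> \<longleftrightarrow> x \<in> space E \<and> \<tau> x \<in> pos_group"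
  by (simp add: gauge_domain_def pos_group_def)

lemma action_domain: "r \<in> pos_group \<Longrightarrow> x \<in> space E \<Longrightarrow> S r x \<in> gauge_domain E \<tau> \<longleftrightarrow> x \<in> gauge_domain E \<tau>"
  by (auto simp: in_domain_iff action_space gauge_action pos_group_def zero_less_mult_iff
      intro: less_asym)

text \<open>
  Polar decomposition of a point: its gauge is the radius, its projection to the section the angle.
\<close>
lemma action_proj:
  assumes "x \<in> gauge_domain E \<tau>"
  shows "S (\<tau> x) (\<pi> x) = x"
  using assms
  by (simp add: gauge_proj_def in_domain_iff action_mult vec_inverse_pos_group vec_inverse_mult action_one)

lemma proj_action:
  assumes r: "r \<in> pos_group" and x: "x \<in> gauge_domain E \<tau>"
  shows "\<pi> (S r x) = \<pi> x"
proof -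
  have [simp]: "x \<in> space E" "\<tau> x \<in> pos_group"
    using x by (auto simp: in_domain_iff)
  have "vec_inverse (r * \<tau> x) * r = vec_inverse (\<tau> x) * (vec_inverse r * r)"
    by (simp add: vec_inverse_def vec_eq_iff)
  then have "vec_inverse (r * \<tau> x) * r = vec_inverse (\<tau> x)"
    using r by (simp add: vec_inverse_mult)
  then show ?thesis
    using x r by (simp add: gauge_proj_def action_domain gauge_action action_mult
        vec_inverse_pos_group mult_pos_group)
qed

lemma kernel_measurable [measurable]:
  assumes [measurable]: "A \<in> sets E"
  shows "K A \<in> borel_measurable E"
  unfolding orbit_kernel_def by measurable

lemma kernel_action:
  assumes [measurable]: "A \<in> sets E" and s: "s \<in> pos_group" and x [measurable]: "x \<in> space E"
  shows "K A (S s x) = ennreal (character \<alpha> s) * K A x"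
proof -
  have "K A (S s x) = (\<integral>\<^sup>+r. indicator A (S (r * s) x) \<partial>theta_measure \<alpha>)"
    unfolding orbit_kernel_def
    by (intro nn_integral_cong) (simp add: space_theta_measure action_mult s x)
  also have "\<dots> = ennreal (character \<alpha> s) * (\<integral>\<^sup>+r. indicator A (S r x) \<partial>theta_measure \<alpha>)"
    by (intro nn_integral_theta_scale s exponent_pos) measurable
  finally show ?thesis
    by (simp add: orbit_kernel_def)
qed

text \<open>
  The orbit kernel sees the radius only through the character. This is why the angular measure, in
  which the radius enters as the weight \<open>character \<alpha> (\<tau> x)\<close>, carries all information.
\<close>
lemma kernel_polar:
  assumes "A \<in> sets E" "x \<in> gauge_domain E \<tau>"
  shows "K A x = ennreal (character \<alpha> (\<tau> x)) * K A (\<pi> x)"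
proof -
  have "\<pi> x \<in> space E"
    using assms(2) by (simp add: gauge_proj_def in_domain_iff action_space vec_inverse_pos_group)
  then show ?thesis
    using kernel_action[of A "\<tau> x" "\<pi> x"] assms by (simp add: action_proj in_domain_iff)
qed

section \<open>Averages of the gauge weight along orbits\<close>

lemma unit_cell_eq: "unit_cell = {r :: real ^ 'q. \<forall>i. r $ i \<in> {1<..2}}"
  by (auto simp: unit_cell_def)

lemma haar_unit_cell: "emeasure (haar_measure \<alpha>) unit_cell = ennreal (\<Prod>i\<in>UNIV. \<alpha> $ i * ln 2)"
  unfolding unit_cell_eq
  by (rule haar_dyadic_box[OF exponent_pos, of 1]) (auto simp: pos_group_def)

lemma haar_unit_cell_pos: "0 < (\<Prod>i\<in>UNIV. \<alpha> $ i * ln 2)"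
  using exponent_pos by (auto intro!: prod_pos)

text \<open>
  To be applied to an orbit \<open>y\<close>, parametrised by \<open>r\<close> or by its inverse. In either case the group
  elements that bring the gauge into the unit cell form a dyadic box, and every dyadic box has the
  Haar mass by which the gauge weight is normalised.
\<close>
lemma nn_integral_weight_eq_1:
  assumes cell: "\<And>r. r \<in> pos_group \<Longrightarrow> \<tau> (y r) \<in> unit_cell \<longleftrightarrow> (\<forall>i. r $ i \<in> J i)"
    and a: "a \<in> pos_group"
    and J: "\<And>i. J i \<in> sets borel" "\<And>i. {a $ i<..<2 * a $ i} \<subseteq> J i" "\<And>i. J i \<subseteq> {a $ i..2 * a $ i}"
  shows "(\<integral>\<^sup>+r. ennreal (gauge_weight \<alpha> \<tau> (y r)) * ennreal (character \<alpha> r) \<partial>theta_measure \<alpha>) = 1"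
proof -
  let ?B = "{r :: real ^ 'q. \<forall>i. r $ i \<in> J i}" and ?d = "\<Prod>i\<in>UNIV. \<alpha> $ i * ln 2"
  have [measurable]: "J i \<in> sets borel" for i
    by (rule J)
  have "0 < a $ i" for i
    using a by (simp add: pos_group_def)
  then have "?B \<subseteq> pos_group"
    using J(3) by (fastforce simp: pos_group_def subset_iff intro: less_le_trans)
  moreover have "?B \<in> sets borel"
    by measurable
  ultimately have B: "?B \<in> sets (theta_measure \<alpha>)"
    by (auto simp: sets_theta_measure sets_restrict_space_iff)
  have d: "measure (haar_measure \<alpha>) unit_cell = ?d"
    using haar_unit_cell haar_unit_cell_pos by (simp add: measure_def)
  have "(\<integral>\<^sup>+r. ennreal (gauge_weight \<alpha> \<tau> (y r)) * ennreal (character \<alpha> r) \<partial>theta_measure \<alpha>) =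
      (\<integral>\<^sup>+r. ennreal (inverse ?d) * (ennreal (character \<alpha> r) * indicator ?B r) \<partial>theta_measure \<alpha>)"
    by (intro nn_integral_cong)
      (auto simp: gauge_weight_def d space_theta_measure cell ac_simps split: split_indicator)
  also have "\<dots> = ennreal (inverse ?d) * emeasure (haar_measure \<alpha>) ?B"
    using B by (simp add: nn_integral_cmult haar_eq_density_theta[OF exponent_pos] emeasure_density)
  also have "\<dots> = ennreal (inverse ?d) * ennreal ?d"
    using haar_dyadic_box[OF exponent_pos a J] by simp
  also have "\<dots> = 1"
    using haar_unit_cell_pos
    by (simp add: ennreal_mult[symmetric] less_imp_le left_inverse less_imp_neq[THEN not_sym])
  finally show ?thesis .
qed

lemma weight_average:
  assumes x: "x \<in> gauge_domain E \<tau>"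
  shows "(\<integral>\<^sup>+r. ennreal (gauge_weight \<alpha> \<tau> (S r x)) * ennreal (character \<alpha> r) \<partial>theta_measure \<alpha>) = 1"
proof (rule nn_integral_weight_eq_1)
  have xE: "x \<in> space E" and t: "0 < \<tau> x $ i" for i
    using x by (auto simp: gauge_domain_def)
  show "\<tau> (S r x) \<in> unit_cell \<longleftrightarrow> (\<forall>i. r $ i \<in> {1 / \<tau> x $ i<..2 / \<tau> x $ i})" if "r \<in> pos_group" for r
    using that t by (simp add: gauge_action xE unit_cell_def field_simps)
  show "vec_inverse (\<tau> x) \<in> pos_group"
    using x by (simp add: in_domain_iff vec_inverse_pos_group)
qed (auto simp: vec_inverse_def divide_inverse)

lemma weight_average_inverse:
  assumes x: "x \<in> gauge_domain E \<tau>"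
  shows "(\<integral>\<^sup>+r. ennreal (gauge_weight \<alpha> \<tau> (S (vec_inverse r) x)) * ennreal (character \<alpha> r)
    \<partial>theta_measure \<alpha>) = 1"
proof (rule nn_integral_weight_eq_1)
  have xE: "x \<in> space E" and t: "0 < \<tau> x $ i" for i
    using x by (auto simp: gauge_domain_def)
  show "\<tau> (S (vec_inverse r) x) \<in> unit_cell \<longleftrightarrow> (\<forall>i. r $ i \<in> {\<tau> x $ i / 2..<\<tau> x $ i})"
    if r: "r \<in> pos_group" for r
  proof -
    have "1 < inverse (r $ i) * \<tau> x $ i \<and> inverse (r $ i) * \<tau> x $ i \<le> 2 \<longleftrightarrow>
        \<tau> x $ i / 2 \<le> r $ i \<and> r $ i < \<tau> x $ i" for i
      using r t[of i] by (auto simp: pos_group_def field_simps)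
    then show ?thesis
      using gauge_action[OF vec_inverse_pos_group[OF r] xE] by (simp add: unit_cell_def) (simp add: vec_inverse_def)
  qed
  show "(\<chi> i. \<tau> x $ i / 2) \<in> pos_group"
    using t by (simp add: pos_group_def)
qed auto

section \<open>Angular measures and measures of random elements\<close>

lemma sets_mu_of: "sets (mu_of E S \<alpha> \<tau> w P Z) = sets \<Sigma>"
  unfolding mu_of_def by (rule sets.sets_measure_of_eq)

lemma sets_profile: "sets (gauge_profile E S \<alpha> \<tau> w \<nu>) = sets \<Sigma>"
  unfolding gauge_profile_def by (rule sets.sets_measure_of_eq)

lemma sets_nu_of: "sets (nu_of E S \<alpha> P Z) = sets E"
  unfolding nu_of_def by (rule sets.sets_measure_of_eq)

text \<open>
  The measures \<open>mu_of\<close>, \<open>gauge_profile\<close> and \<open>nu_of\<close> are image measures. In this form integrals of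
  arbitrary nonnegative functions against them can be computed.
\<close>
lemma mu_of_eq_distr:
  assumes Z: "random_element E P Z"
  shows "mu_of E S \<alpha> \<tau> w P Z =
    distr (density P (\<lambda>\<omega>. ennreal (character \<alpha> (\<tau> (Z \<omega>))))) \<Sigma> (\<lambda>\<omega>. \<pi> (Z \<omega>))"
proof (rule measure_eqI)
  have [measurable]: "Z \<in> P \<rightarrow>\<^sub>M E"
    using Z by (simp add: random_element_def)
  fix D assume "D \<in> sets (mu_of E S \<alpha> \<tau> w P Z)"
  then have D [measurable]: "D \<in> sets \<Sigma>"
    by (simp add: sets_mu_of)
  show "emeasure (mu_of E S \<alpha> \<tau> w P Z) D =
      emeasure (distr (density P (\<lambda>\<omega>. ennreal (character \<alpha> (\<tau> (Z \<omega>))))) \<Sigma> (\<lambda>\<omega>. \<pi> (Z \<omega>))) D"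
    by (subst emeasure_mu_of[OF action gauge base_point Z D])
      (auto simp: emeasure_distr emeasure_density intro!: nn_integral_cong split: split_indicator)
qed (simp add: sets_mu_of)

lemma profile_eq_distr:
  assumes \<nu>: "sets \<nu> = sets E"
  shows "gauge_profile E S \<alpha> \<tau> w \<nu> =
    distr (density \<nu> (\<lambda>x. ennreal (character \<alpha> (\<tau> x) * gauge_weight \<alpha> \<tau> x) *
      indicator (gauge_domain E \<tau>) x)) \<Sigma> \<pi>"
proof (rule measure_eqI)
  note [measurable_cong] = \<nu>
  fix D assume "D \<in> sets (gauge_profile E S \<alpha> \<tau> w \<nu>)"
  then have D [measurable]: "D \<in> sets \<Sigma>"
    by (simp add: sets_profile)
  show "emeasure (gauge_profile E S \<alpha> \<tau> w \<nu>) D =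
      emeasure (distr (density \<nu> (\<lambda>x. ennreal (character \<alpha> (\<tau> x) * gauge_weight \<alpha> \<tau> x) *
      indicator (gauge_domain E \<tau>) x)) \<Sigma> \<pi>) D"
    by (subst emeasure_gauge_profile[OF action gauge base_point \<nu> D])
      (auto simp: emeasure_distr emeasure_density intro!: nn_integral_cong split: split_indicator)
qed (simp add: sets_profile)


lemma nu_of_eq_distr:
  assumes Z: "random_element E P Z"
  shows "nu_of E S \<alpha> P Z = distr (P \<Otimes>\<^sub>M theta_measure \<alpha>) E (\<lambda>(\<omega>, r). S r (Z \<omega>))"
proof (rule measure_eqI)
  have [measurable]: "Z \<in> P \<rightarrow>\<^sub>M E"
    using Z by (simp add: random_element_def)
  fix A assume "A \<in> sets (nu_of E S \<alpha> P Z)"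
  then have A [measurable]: "A \<in> sets E"
    by (simp add: sets_nu_of)
  have "emeasure (distr (P \<Otimes>\<^sub>M theta_measure \<alpha>) E (\<lambda>(\<omega>, r). S r (Z \<omega>))) A =
      (\<integral>\<^sup>+p. indicator A (S (snd p) (Z (fst p))) \<partial>(P \<Otimes>\<^sub>M theta_measure \<alpha>))"
    by (simp add: nn_integral_indicator[symmetric] nn_integral_distr case_prod_beta'
        del: nn_integral_indicator)
  also have "\<dots> = emeasure (nu_of E S \<alpha> P Z) A"
    by (simp add: emeasure_nu_of[OF action Z A] theta.nn_integral_fst[symmetric])
  finally show "emeasure (nu_of E S \<alpha> P Z) A =
      emeasure (distr (P \<Otimes>\<^sub>M theta_measure \<alpha>) E (\<lambda>(\<omega>, r). S r (Z \<omega>))) A" ..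
qed (simp add: sets_nu_of)

lemma nn_integral_nu_of:
  assumes Z: "random_element E P Z" and [measurable]: "f \<in> borel_measurable E"
  shows "(\<integral>\<^sup>+x. f x \<partial>nu_of E S \<alpha> P Z) = (\<integral>\<^sup>+\<omega>. \<integral>\<^sup>+r. f (S r (Z \<omega>)) \<partial>theta_measure \<alpha> \<partial>P)"
proof -
  have [measurable]: "Z \<in> P \<rightarrow>\<^sub>M E"
    using Z by (simp add: random_element_def)
  show ?thesis
    by (simp add: nu_of_eq_distr[OF Z] nn_integral_distr theta.nn_integral_fst[symmetric])
qed

lemma concentrated_AE:
  assumes Z: "random_element E P Z" and "concentrated_on P Z (gauge_domain E \<tau>)"
  shows "AE \<omega> in P. Z \<omega> \<in> gauge_domain E \<tau>"
proof -
  interpret prob_space P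
    using Z by (simp add: random_element_def)
  show ?thesis
    using AE_prob_1 assms(2) by (fastforce simp: concentrated_on_def elim: eventually_mono)
qed

lemma emeasure_nu_of_disintegration:
  assumes Z: "random_element E P Z" and conc: "concentrated_on P Z (gauge_domain E \<tau>)"
    and A: "A \<in> sets E"
  shows "emeasure (nu_of E S \<alpha> P Z) A = (\<integral>\<^sup>+y. K A y \<partial>mu_of E S \<alpha> \<tau> w P Z)"
proof -
  have [measurable]: "Z \<in> P \<rightarrow>\<^sub>M E"
    using Z by (simp add: random_element_def)
  have [measurable]: "K A \<in> borel_measurable \<Sigma>"
    by (rule measurable_restrict_space1) (rule kernel_measurable[OF A])
  have "emeasure (nu_of E S \<alpha> P Z) A = (\<integral>\<^sup>+\<omega>. K A (Z \<omega>) \<partial>P)"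
    by (simp add: emeasure_nu_of[OF action Z A] orbit_kernel_def)
  also have "\<dots> = (\<integral>\<^sup>+\<omega>. ennreal (character \<alpha> (\<tau> (Z \<omega>))) * K A (\<pi> (Z \<omega>)) \<partial>P)"
    using concentrated_AE[OF Z conc]
    by (intro nn_integral_cong_AE, eventually_elim) (rule kernel_polar[OF A])
  also have "\<dots> = (\<integral>\<^sup>+y. K A y \<partial>mu_of E S \<alpha> \<tau> w P Z)"
    by (simp add: mu_of_eq_distr[OF Z] nn_integral_distr nn_integral_density)
  finally show ?thesis .
qed

text \<open>
  An orbit started at a point \<open>x\<close> of the gauge domain has constant angle, and its gauge is
  \<open>r * \<tau> x\<close>. Hence the profile integrand along the orbit is the wanted value
  \<open>character \<alpha> (\<tau> x) * indicator D (\<pi> x)\<close> times \<open>character \<alpha> r\<close> times the weight at \<open>S r x\<close>, and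
  the last two factors integrate to 1.
\<close>
lemma mu_of_eq_profile_nu_of:
  assumes Z: "random_element E P Z" and conc: "concentrated_on P Z (gauge_domain E \<tau>)"
  shows "mu_of E S \<alpha> \<tau> w P Z = gauge_profile E S \<alpha> \<tau> w (nu_of E S \<alpha> P Z)"
proof (rule measure_eqI)
  have Zm [measurable]: "Z \<in> P \<rightarrow>\<^sub>M E"
    using Z by (simp add: random_element_def)
  fix D assume "D \<in> sets (mu_of E S \<alpha> \<tau> w P Z)"
  then have D [measurable]: "D \<in> sets \<Sigma>"
    by (simp add: sets_mu_of)
  let ?F = "\<lambda>x. ennreal (character \<alpha> (\<tau> x) * gauge_weight \<alpha> \<tau> x) * indicator D (\<pi> x) *
    indicator (gauge_domain E \<tau>) x"
  have orbit: "(\<integral>\<^sup>+r. ?F (S r x) \<partial>theta_measure \<alpha>) =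
      ennreal (character \<alpha> (\<tau> x)) * indicator D (\<pi> x)" if x: "x \<in> gauge_domain E \<tau>" for x
  proof -
    have xE [measurable]: "x \<in> space E" and t: "\<tau> x \<in> pos_group"
      using x by (auto simp: in_domain_iff)
    have "(\<integral>\<^sup>+r. ?F (S r x) \<partial>theta_measure \<alpha>) =
        (\<integral>\<^sup>+r. (ennreal (character \<alpha> (\<tau> x)) * indicator D (\<pi> x)) *
          (ennreal (gauge_weight \<alpha> \<tau> (S r x)) * ennreal (character \<alpha> r)) \<partial>theta_measure \<alpha>)"
    proof (intro nn_integral_cong)
      fix r assume "r \<in> space (theta_measure \<alpha>)"
      then have r: "r \<in> pos_group"
        by (simp add: space_theta_measure)
      have "0 \<le> gauge_weight \<alpha> \<tau> (S r x)"
        by (simp add: gauge_weight_def)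
      moreover have "0 \<le> character \<alpha> r" "0 \<le> character \<alpha> (\<tau> x)"
        using r t by (auto intro: less_imp_le character_pos)
      ultimately show "?F (S r x) = (ennreal (character \<alpha> (\<tau> x)) * indicator D (\<pi> x)) *
          (ennreal (gauge_weight \<alpha> \<tau> (S r x)) * ennreal (character \<alpha> r))"
        using r x
        by (simp add: gauge_action xE character_mult t proj_action action_domain ennreal_mult ac_simps)
    qed
    then show ?thesis
      by (simp add: nn_integral_cmult weight_average[OF x])
  qed
  have "emeasure (gauge_profile E S \<alpha> \<tau> w (nu_of E S \<alpha> P Z)) D = (\<integral>\<^sup>+x. ?F x \<partial>nu_of E S \<alpha> P Z)"
    by (rule emeasure_gauge_profile[OF action gauge base_point sets_nu_of D])
  also have "\<dots> = (\<integral>\<^sup>+\<omega>. \<integral>\<^sup>+r. ?F (S r (Z \<omega>)) \<partial>theta_measure \<alpha> \<partial>P)"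
    by (rule nn_integral_nu_of[OF Z]) measurable
  also have "\<dots> = (\<integral>\<^sup>+\<omega>. ennreal (character \<alpha> (\<tau> (Z \<omega>))) * indicator D (\<pi> (Z \<omega>)) \<partial>P)"
    using concentrated_AE[OF Z conc]
    by (intro nn_integral_cong_AE, eventually_elim) (rule orbit)
  also have "\<dots> = emeasure (mu_of E S \<alpha> \<tau> w P Z) D"
    by (rule emeasure_mu_of[OF action gauge base_point Z D, symmetric])
  finally show "emeasure (mu_of E S \<alpha> \<tau> w P Z) D =
      emeasure (gauge_profile E S \<alpha> \<tau> w (nu_of E S \<alpha> P Z)) D" ..
qed (simp add: sets_mu_of sets_profile)

section \<open>Homogeneous measures are determined by their profile\<close>

text \<open>
  Homogeneity speaks of images \<open>S r ` A\<close>. Since \<open>S r\<close> is invertible, the preimage of \<open>B\<close> under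
  \<open>S r\<close> is the image under \<open>S (vec_inverse r)\<close>, so pushing the measure forward by \<open>S r\<close> multiplies
  it by the character of \<open>r\<close>.
\<close>
lemma nn_integral_homogeneous:
  assumes \<nu>: "sets \<nu> = sets E" "homogeneous E S \<alpha> \<nu>" and r: "r \<in> pos_group"
    and f: "f \<in> borel_measurable E"
  shows "(\<integral>\<^sup>+x. f (S r x) \<partial>\<nu>) = ennreal (character \<alpha> r) * (\<integral>\<^sup>+x. f x \<partial>\<nu>)"
proof -
  note [measurable_cong] = \<nu>(1)
  have [measurable]: "r \<in> space (theta_measure \<alpha>)"
    using r by (simp add: space_theta_measure)
  have sp: "space \<nu> = space E"
    by (rule sets_eq_imp_space_eq[OF \<nu>(1)])
  have [measurable]: "f \<in> borel_measurable \<nu>"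
    using f by measurable
  have "distr \<nu> E (S r) = density \<nu> (\<lambda>_. ennreal (character \<alpha> r))"
  proof (rule measure_eqI)
    fix B assume "B \<in> sets (distr \<nu> E (S r))"
    then have B [measurable]: "B \<in> sets E"
      by simp
    have "S r -` B \<inter> space E = S (vec_inverse r) ` B"
    proof (intro set_eqI iffI)
      fix x assume x: "x \<in> S r -` B \<inter> space E"
      then have "x = S (vec_inverse r) (S r x)"
        using r by (simp add: action_mult vec_inverse_pos_group vec_inverse_mult action_one)
      with x show "x \<in> S (vec_inverse r) ` B" by blast
    next
      fix x assume "x \<in> S (vec_inverse r) ` B"
      then show "x \<in> S r -` B \<inter> space E"
        using r sets.sets_into_space[OF B]
        by (auto simp: action_mult vec_inverse_pos_group vec_inverse_mult action_one action_space subset_iff)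
    qed
    then have "emeasure (distr \<nu> E (S r)) B = emeasure \<nu> (S (vec_inverse r) ` B)"
      by (simp add: emeasure_distr sp)
    also have "\<dots> = ennreal (character \<alpha> r) * emeasure \<nu> B"
      using \<nu>(2) B r by (simp add: homogeneous_def vec_inverse_pos_group character_vec_inverse)
    finally show "emeasure (distr \<nu> E (S r)) B = emeasure (density \<nu> (\<lambda>_. ennreal (character \<alpha> r))) B"
      using B \<nu>(1) by (simp add: emeasure_density nn_integral_cmult_indicator)
  qed (simp add: \<nu>(1))
  then have "(\<integral>\<^sup>+x. f x \<partial>distr \<nu> E (S r)) = (\<integral>\<^sup>+x. f x \<partial>density \<nu> (\<lambda>_. ennreal (character \<alpha> r)))"
    by simp
  then show ?thesis
    using f by (simp add: nn_integral_distr nn_integral_density nn_integral_cmult)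
qed

text \<open>
  The profile is built so that integrating the kernel against it gives the \<open>\<nu>\<close>-integral of weight
  times kernel. Write the kernel as an orbit integral, exchange it with \<open>\<nu>\<close>, and use homogeneity to
  move \<open>S r\<close> from the indicator of \<open>A\<close> to the weight; after a second exchange the weight averages
  to 1. Both exchanges need \<open>\<nu>\<close> to be \<open>\<sigma>\<close>-finite.
\<close>
lemma emeasure_eq_kernel_profile:
  assumes \<nu>: "\<nu> \<in> sigma_finite_homogeneous E S \<alpha>" and adm: "admissible E \<tau> \<nu>"
    and A [measurable]: "A \<in> sets E"
  shows "emeasure \<nu> A = (\<integral>\<^sup>+y. K A y \<partial>gauge_profile E S \<alpha> \<tau> w \<nu>)"
proof -
  have s [measurable_cong]: "sets \<nu> = sets E" and hom: "homogeneous E S \<alpha> \<nu>"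
    using \<nu> by (auto simp: sigma_finite_homogeneous_def)
  have sp: "space \<nu> = space E"
    by (rule sets_eq_imp_space_eq[OF s])
  interpret nu: sigma_finite_measure \<nu>
    using \<nu> by (simp add: sigma_finite_homogeneous_def)
  interpret pair_sigma_finite \<nu> "theta_measure \<alpha>" ..
  have [measurable]: "K A \<in> borel_measurable \<Sigma>"
    by (rule measurable_restrict_space1) (rule kernel_measurable[OF A])
  let ?h = "\<lambda>x. ennreal (gauge_weight \<alpha> \<tau> x)"
  \<comment> \<open>points outside the domain have no polar decomposition, but admissibility makes them null\<close>
  have dom: "AE x in \<nu>. x \<in> gauge_domain E \<tau>"
    using adm by (intro AE_I[of _ _ "space E - gauge_domain E \<tau>"]) (auto simp: admissible_def sp s)
  have "(\<integral>\<^sup>+y. K A y \<partial>gauge_profile E S \<alpha> \<tau> w \<nu>) =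
      (\<integral>\<^sup>+x. ennreal (character \<alpha> (\<tau> x) * gauge_weight \<alpha> \<tau> x) * indicator (gauge_domain E \<tau>) x *
        K A (\<pi> x) \<partial>\<nu>)"
    by (simp add: profile_eq_distr[OF s] nn_integral_distr nn_integral_density)
  also have "\<dots> = (\<integral>\<^sup>+x. ?h x * K A x \<partial>\<nu>)"
    using dom
  proof (intro nn_integral_cong_AE, eventually_elim)
    fix x assume x: "x \<in> gauge_domain E \<tau>"
    have "0 \<le> gauge_weight \<alpha> \<tau> x" "0 \<le> character \<alpha> (\<tau> x)"
      using x by (auto simp: gauge_weight_def in_domain_iff intro: less_imp_le character_pos)
    then show "ennreal (character \<alpha> (\<tau> x) * gauge_weight \<alpha> \<tau> x) * indicator (gauge_domain E \<tau>) x *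
        K A (\<pi> x) = ?h x * K A x"
      using x by (simp add: kernel_polar[OF A x] ennreal_mult ac_simps)
  qed
  also have "\<dots> = (\<integral>\<^sup>+x. \<integral>\<^sup>+r. ?h x * indicator A (S r x) \<partial>theta_measure \<alpha> \<partial>\<nu>)"
    unfolding orbit_kernel_def
    by (intro nn_integral_cong nn_integral_cmult[symmetric]) (simp add: sp, measurable)
  also have "\<dots> = (\<integral>\<^sup>+r. \<integral>\<^sup>+x. ?h x * indicator A (S r x) \<partial>\<nu> \<partial>theta_measure \<alpha>)"
    by (rule Fubini'[symmetric]) measurable
  also have "\<dots> = (\<integral>\<^sup>+r. \<integral>\<^sup>+x. ?h (S (vec_inverse r) x) * ennreal (character \<alpha> r) * indicator A x
      \<partial>\<nu> \<partial>theta_measure \<alpha>)"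
  proof (rule nn_integral_cong)
    fix r assume r' [measurable]: "r \<in> space (theta_measure \<alpha>)"
    then have r: "r \<in> pos_group"
      by (simp add: space_theta_measure)
    have [measurable]: "vec_inverse r \<in> space (theta_measure \<alpha>)"
      using r by (simp add: space_theta_measure vec_inverse_pos_group)
    \<comment> \<open>make the integrand a function of \<open>S r x\<close>, so that homogeneity applies\<close>
    have "(\<integral>\<^sup>+x. ?h x * indicator A (S r x) \<partial>\<nu>) =
        (\<integral>\<^sup>+x. ?h (S (vec_inverse r) (S r x)) * indicator A (S r x) \<partial>\<nu>)"
      using r by (intro nn_integral_cong)
        (simp add: sp action_mult vec_inverse_pos_group vec_inverse_mult action_one)
    also have "\<dots> = ennreal (character \<alpha> r) * (\<integral>\<^sup>+x. ?h (S (vec_inverse r) x) * indicator A x \<partial>\<nu>)"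
      by (rule nn_integral_homogeneous[OF s hom r]) measurable
    also have "\<dots> = (\<integral>\<^sup>+x. ?h (S (vec_inverse r) x) * ennreal (character \<alpha> r) * indicator A x \<partial>\<nu>)"
      by (subst nn_integral_cmult[symmetric]) (simp_all add: ac_simps)
    finally show "(\<integral>\<^sup>+x. ?h x * indicator A (S r x) \<partial>\<nu>) =
        (\<integral>\<^sup>+x. ?h (S (vec_inverse r) x) * ennreal (character \<alpha> r) * indicator A x \<partial>\<nu>)" .
  qed
  also have "\<dots> = (\<integral>\<^sup>+x. \<integral>\<^sup>+r. ?h (S (vec_inverse r) x) * ennreal (character \<alpha> r) * indicator A x
      \<partial>theta_measure \<alpha> \<partial>\<nu>)"
    by (rule Fubini') measurable
  also have "\<dots> = (\<integral>\<^sup>+x. indicator A x \<partial>\<nu>)"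
    using dom
  proof (intro nn_integral_cong_AE, eventually_elim)
    fix x assume x: "x \<in> gauge_domain E \<tau>"
    then have [measurable]: "x \<in> space E"
      by (simp add: in_domain_iff)
    show "(\<integral>\<^sup>+r. ?h (S (vec_inverse r) x) * ennreal (character \<alpha> r) * indicator A x
        \<partial>theta_measure \<alpha>) = indicator A x"
      by (simp add: nn_integral_multc weight_average_inverse[OF x])
  qed
  finally show ?thesis
    by (simp add: s)
qed

section \<open>Concentration and uniqueness\<close>

text \<open>
  Haar measure has a density with respect to \<open>theta_measure\<close> and charges the unit cell.
\<close>
lemma theta_nonzero: "emeasure (theta_measure \<alpha>) pos_group \<noteq> 0"
proof
  assume "emeasure (theta_measure \<alpha>) pos_group = 0"
  then have "AE r in theta_measure \<alpha>. r \<notin> unit_cell"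
    by (intro AE_I[of _ _ pos_group])
      (auto simp: space_theta_measure sets_theta_measure sets_restrict_space_iff)
  moreover have "unit_cell \<in> sets (theta_measure \<alpha>)"
    by (auto simp: sets_theta_measure sets_restrict_space_iff unit_cell_def pos_group_def intro: less_trans[OF zero_less_one])
  ultimately have "emeasure (haar_measure \<alpha>) unit_cell = 0"
    by (auto simp: haar_eq_density_theta[OF exponent_pos] emeasure_density nn_integral_0_iff_AE)
  then show False
    using haar_unit_cell haar_unit_cell_pos by (metis ennreal_eq_0_iff not_le)
qed

text \<open>
  The complement of the gauge domain is a union of orbits, so its mass under \<open>nu_of\<close> is the
  probability that \<open>Z\<close> lies in it times the total mass of \<open>theta_measure\<close>.
\<close>
lemma representer_concentrated:
  assumes rep: "stochastic_representer E S \<alpha> \<nu> P Z" and adm: "admissible E \<tau> \<nu>"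
  shows "concentrated_on P Z (gauge_domain E \<tau>)"
proof -
  let ?N = "space E - gauge_domain E \<tau>"
  have Z: "random_element E P Z" and \<nu>: "\<nu> = nu_of E S \<alpha> P Z"
    using rep by (auto simp: stochastic_representer_def)
  interpret prob_space P
    using Z by (simp add: random_element_def)
  have [measurable]: "Z \<in> P \<rightarrow>\<^sub>M E"
    using Z by (simp add: random_element_def)
  have ZE: "Z \<omega> \<in> space E" if "\<omega> \<in> space P" for \<omega>
    using that by (rule measurable_space[OF \<open>Z \<in> P \<rightarrow>\<^sub>M E\<close>])
  have "0 = (\<integral>\<^sup>+\<omega>. \<integral>\<^sup>+r. indicator ?N (S r (Z \<omega>)) \<partial>theta_measure \<alpha> \<partial>P)"
    using adm by (simp add: admissible_def \<nu> emeasure_nu_of[OF action Z])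
  also have "\<dots> = (\<integral>\<^sup>+\<omega>. indicator ?N (Z \<omega>) * emeasure (theta_measure \<alpha>) pos_group \<partial>P)"
  proof (intro nn_integral_cong)
    fix \<omega> assume \<omega>: "\<omega> \<in> space P"
    have "(\<integral>\<^sup>+r. indicator ?N (S r (Z \<omega>)) \<partial>theta_measure \<alpha>) =
        (\<integral>\<^sup>+r. indicator ?N (Z \<omega>) \<partial>theta_measure \<alpha>)"
      by (intro nn_integral_cong)
        (simp add: indicator_def space_theta_measure action_space action_domain ZE[OF \<omega>])
    then show "(\<integral>\<^sup>+r. indicator ?N (S r (Z \<omega>)) \<partial>theta_measure \<alpha>) =
        indicator ?N (Z \<omega>) * emeasure (theta_measure \<alpha>) pos_group"
      by (simp add: space_theta_measure)
  qed
  finally have "AE \<omega> in P. indicator ?N (Z \<omega>) * emeasure (theta_measure \<alpha>) pos_group = 0"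
    by (subst (asm) eq_commute, subst (asm) nn_integral_0_iff_AE) auto
  then have "AE \<omega> in P. Z \<omega> \<in> gauge_domain E \<tau>"
    using AE_space by eventually_elim (use theta_nonzero ZE in \<open>auto simp: indicator_def split: if_splits\<close>)
  then have "AE \<omega> in P. \<omega> \<in> {\<omega> \<in> space P. Z \<omega> \<in> gauge_domain E \<tau>}"
    using AE_space by eventually_elim simp
  then show ?thesis
    by (subst (asm) AE_in_set_eq_1) (auto simp: concentrated_on_def)
qed

lemma nu_of_eq_iff:
  assumes \<nu>: "\<nu> \<in> sigma_finite_homogeneous E S \<alpha>" and adm: "admissible E \<tau> \<nu>"
    and Z: "random_element E P Z" "concentrated_on P Z (gauge_domain E \<tau>)"
  shows "nu_of E S \<alpha> P Z = \<nu> \<longleftrightarrow> mu_of E S \<alpha> \<tau> w P Z = gauge_profile E S \<alpha> \<tau> w \<nu>"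
proof
  assume "mu_of E S \<alpha> \<tau> w P Z = gauge_profile E S \<alpha> \<tau> w \<nu>"
  then show "nu_of E S \<alpha> P Z = \<nu>"
    using \<nu>
    by (intro measure_eqI)
      (auto simp: sets_nu_of emeasure_nu_of_disintegration[OF Z] emeasure_eq_kernel_profile[OF \<nu> adm]
        sigma_finite_homogeneous_def)
qed (use mu_of_eq_profile_nu_of[OF Z] in simp)

lemma nu_of_eq_nu_of_iff:
  assumes Z: "random_element E P Z" "concentrated_on P Z (gauge_domain E \<tau>)"
    and W: "random_element E Q W" "concentrated_on Q W (gauge_domain E \<tau>)"
  shows "nu_of E S \<alpha> P Z = nu_of E S \<alpha> Q W \<longleftrightarrow> mu_of E S \<alpha> \<tau> w P Z = mu_of E S \<alpha> \<tau> w Q W"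
proof
  assume "mu_of E S \<alpha> \<tau> w P Z = mu_of E S \<alpha> \<tau> w Q W"
  then show "nu_of E S \<alpha> P Z = nu_of E S \<alpha> Q W"
    by (intro measure_eqI)
      (auto simp: sets_nu_of emeasure_nu_of_disintegration[OF Z] emeasure_nu_of_disintegration[OF W])
qed (simp add: mu_of_eq_profile_nu_of[OF Z] mu_of_eq_profile_nu_of[OF W])

end

section \<open>Representers and their angular measures\<close>

theorem proposition3p2:
  fixes E :: "'e measure"
    and S :: "real ^ 'q \<Rightarrow> 'e \<Rightarrow> 'e"
    and \<alpha> :: "real ^ 'q"
    and \<nu> :: "'e measure"
    and \<tau> :: "'e \<Rightarrow> real ^ 'q"
    and w :: 'e
  assumes "measurable_action E S"
    and "\<forall>i. 0 < \<alpha> $ i"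
    and "\<nu> \<in> sigma_finite_homogeneous E S \<alpha>"
    and "product_gauge E S \<tau>"
    and "admissible E \<tau> \<nu>"
    and "w \<in> gauge_section E \<tau>"
  shows
    "(\<forall>(P :: 'p measure) Z. stochastic_representer E S \<alpha> \<nu> P Z \<longrightarrow>
        concentrated_on P Z (gauge_domain E \<tau>)) \<and>
     (\<forall>(P :: 'p measure) Z. random_element E P Z \<and> concentrated_on P Z (gauge_domain E \<tau>) \<longrightarrow>
        (\<forall>\<omega>\<in>space P. gauge_proj E S \<tau> w (Z \<omega>) \<in> gauge_section E \<tau>) \<and>
        (AE \<omega> in P. Z \<omega> = S (\<tau> (Z \<omega>)) (gauge_proj E S \<tau> w (Z \<omega>))) \<and>
        (\<forall>A\<in>sets E. emeasure (nu_of E S \<alpha> P Z) A =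
           (\<integral>\<^sup>+y. orbit_kernel S \<alpha> A y \<partial>mu_of E S \<alpha> \<tau> w P Z)) \<and>
        (\<forall>D\<in>sets (restrict_space E (gauge_section E \<tau>)). emeasure (mu_of E S \<alpha> \<tau> w P Z) D =
           (\<integral>\<^sup>+x\<in>gauge_domain E \<tau>. ennreal (character \<alpha> (\<tau> x) * gauge_weight \<alpha> \<tau> x) *
              indicator D (gauge_proj E S \<tau> w x) \<partial>nu_of E S \<alpha> P Z)) \<and>
        (nu_of E S \<alpha> P Z = \<nu> \<longleftrightarrow> mu_of E S \<alpha> \<tau> w P Z = gauge_profile E S \<alpha> \<tau> w \<nu>)) \<and>
     (\<forall>(P :: 'p measure) Z (Q :: 'r measure) W.
        random_element E P Z \<and> concentrated_on P Z (gauge_domain E \<tau>) \<and>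
        random_element E Q W \<and> concentrated_on Q W (gauge_domain E \<tau>) \<longrightarrow>
        (nu_of E S \<alpha> P Z = nu_of E S \<alpha> Q W \<longleftrightarrow>
         mu_of E S \<alpha> \<tau> w P Z = mu_of E S \<alpha> \<tau> w Q W))"
proof -
  interpret gauged_action E S \<alpha> \<tau> w
    by (rule gauged_action.intro) fact+
  note \<nu> = assms(3) and adm = assms(5)
  show ?thesis
  proof (intro conjI allI impI ballI; (elim conjE)?)
    fix P :: "'p measure" and Z
    assume "stochastic_representer E S \<alpha> \<nu> P Z"
    then show "concentrated_on P Z (gauge_domain E \<tau>)"
      using adm by (rule representer_concentrated)
  next
    fix P :: "'p measure" and Z
    assume Z: "random_element E P Z" "concentrated_on P Z (gauge_domain E \<tau>)"
    have [measurable]: "Z \<in> P \<rightarrow>\<^sub>M E"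
      using Z by (simp add: random_element_def)
    show "\<pi> (Z \<omega>) \<in> gauge_section E \<tau>" if "\<omega> \<in> space P" for \<omega>
      using measurable_space[OF proj_measurable measurable_space[OF \<open>Z \<in> P \<rightarrow>\<^sub>M E\<close> that]]
      by (simp add: space_restrict_space)
    show "AE \<omega> in P. Z \<omega> = S (\<tau> (Z \<omega>)) (\<pi> (Z \<omega>))"
      using concentrated_AE[OF Z] by eventually_elim (simp add: action_proj)
    show "emeasure (nu_of E S \<alpha> P Z) A = (\<integral>\<^sup>+y. K A y \<partial>mu_of E S \<alpha> \<tau> w P Z)"
      if "A \<in> sets E" for A
      by (rule emeasure_nu_of_disintegration[OF Z that])
    show "emeasure (mu_of E S \<alpha> \<tau> w P Z) D =
        (\<integral>\<^sup>+x\<in>gauge_domain E \<tau>. ennreal (character \<alpha> (\<tau> x) * gauge_weight \<alpha> \<tau> x) *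
          indicator D (\<pi> x) \<partial>nu_of E S \<alpha> P Z)" if "D \<in> sets \<Sigma>" for D
      unfolding mu_of_eq_profile_nu_of[OF Z]
      by (rule emeasure_gauge_profile[OF action gauge base_point sets_nu_of that])
    show "nu_of E S \<alpha> P Z = \<nu> \<longleftrightarrow> mu_of E S \<alpha> \<tau> w P Z = gauge_profile E S \<alpha> \<tau> w \<nu>"
      by (rule nu_of_eq_iff[OF \<nu> adm Z])
  next
    fix P :: "'p measure" and Z and Q :: "'r measure" and W
    assume "random_element E P Z" "concentrated_on P Z (gauge_domain E \<tau>)"
      "random_element E Q W" "concentrated_on Q W (gauge_domain E \<tau>)"
    then show "nu_of E S \<alpha> P Z = nu_of E S \<alpha> Q W \<longleftrightarrow> mu_of E S \<alpha> \<tau> w P Z = mu_of E S \<alpha> \<tau> w Q W"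
      by (rule nu_of_eq_nu_of_iff)
  qed
qed

end
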